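(* Let $\mathscr{C}$ be a nonempty weakly compact convex subset of a Banach space $\mathcal{E}$. Then every demicontinuous mapping $f\colon\mathscr{C}\to\mathscr{C}$ has a weak-approximate fixed point sequence, that is, there is a sequence $\{x_n\}$ in $\mathscr{C}$ such that $x_n-f(x_n)\rightharpoonup 0$ (weak convergence in $\mathcal{E}$).
   Context: A mapping $f\colon\mathscr{C}\to\mathscr{C}$ is called demicontinuous if it maps strongly (norm) convergent sequences into weakly convergent sequences, i.e. $x_n\to x$ in norm with $x_n,x\in\mathscr{C}$ implies $f(x_n)\rightharpoonup f(x)$ weakly. *)

theory Defs
  imports "HOL-Analysis.Analysis"
begin

text \<open>
  The weak topology is generated by all norm-continuous real-linear functionals.
  If the space carries a complex structure, its complex functionals generate the same
  topology, since a complex functional is determined by its real part.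
\<close>

definition weak_topology :: "'a::real_normed_vector topology" where
  "weak_topology =
     topology_generated_by {\<phi> -` U | (\<phi> :: 'a \<Rightarrow> real) U. bounded_linear \<phi> \<and> open U}"

definition weakly_compact :: "'a::real_normed_vector set \<Rightarrow> bool" where
  "weakly_compact C \<longleftrightarrow> compactin weak_topology C"

definition weakly_converges_to :: "(nat \<Rightarrow> 'a::real_normed_vector) \<Rightarrow> 'a \<Rightarrow> bool" where
  "weakly_converges_to x l \<longleftrightarrow> limitin weak_topology x l sequentially"

definition demicontinuous_on :: "'a::real_normed_vector set \<Rightarrow> ('a \<Rightarrow> 'a) \<Rightarrow> bool" where
  "demicontinuous_on C f \<longleftrightarrow>
     (\<forall>x l. (\<forall>n. x n \<in> C) \<and> l \<in> C \<and> x \<longlonglongrightarrow> l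
        \<longrightarrow> weakly_converges_to (\<lambda>n. f (x n)) (f l))"

lemma topspace_weak_topology [simp]:
  "topspace (weak_topology :: 'a::real_normed_vector topology) = UNIV"
proof -
  have "(\<lambda>_. 0 :: real) -` UNIV \<in>
      {\<phi> -` U | (\<phi> :: 'a \<Rightarrow> real) U. bounded_linear \<phi> \<and> open U}"
    using bounded_linear_zero open_UNIV by blast
  then show ?thesis
    unfolding weak_topology_def topology_generated_by_topspace by auto
qed

lemma weakly_converges_to_iff:
  fixes x :: "nat \<Rightarrow> 'a::real_normed_vector"
  shows "weakly_converges_to x l \<longleftrightarrow>
     (\<forall>\<phi> :: 'a \<Rightarrow> real. bounded_linear \<phi> \<longrightarrow> (\<lambda>n. \<phi> (x n)) \<longlonglongrightarrow> \<phi> l)"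
proof (intro iffI allI impI)
  fix \<phi> :: "'a \<Rightarrow> real"
  assume w: "weakly_converges_to x l" and b: "bounded_linear \<phi>"
  show "(\<lambda>n. \<phi> (x n)) \<longlonglongrightarrow> \<phi> l"
  proof (rule topological_tendstoI)
    fix U :: "real set" assume U: "open U" "\<phi> l \<in> U"
    have "openin weak_topology (\<phi> -` U)"
      unfolding weak_topology_def by (rule topology_generated_by_Basis) (use b U in blast)
    then show "eventually (\<lambda>n. \<phi> (x n) \<in> U) sequentially"
      using w U unfolding weakly_converges_to_def limitin_def by force
  qed
next
  assume h: "\<forall>\<phi> :: 'a \<Rightarrow> real. bounded_linear \<phi> \<longrightarrow> (\<lambda>n. \<phi> (x n)) \<longlonglongrightarrow> \<phi> l"
  have "eventually (\<lambda>n. x n \<in> V) sequentially"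
    if "generate_topology_on
          {\<phi> -` U | (\<phi> :: 'a \<Rightarrow> real) U. bounded_linear \<phi> \<and> open U} V" "l \<in> V" for V
    using that
  proof (induction rule: generate_topology_on.induct)
    case Empty
    then show ?case by simp
  next
    case (Int a b)
    then show ?case by (auto intro: eventually_conj)
  next
    case (UN K)
    then obtain k where "k \<in> K" "l \<in> k" by auto
    with UN.IH have "eventually (\<lambda>n. x n \<in> k) sequentially" by blast
    then show ?case by (rule eventually_mono) (use \<open>k \<in> K\<close> in auto)
  next
    case (Basis s)
    then obtain \<phi> :: "'a \<Rightarrow> real" and U where
      s: "s = \<phi> -` U" "bounded_linear \<phi>" "open U" by blast
    with h Basis show ?case by (auto dest: topological_tendstoD)
  qed
  then have "eventually (\<lambda>n. x n \<in> V) sequentially" if "openin weak_topology V" "l \<in> V" for V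
    using that unfolding weak_topology_def openin_topology_generated_by_iff by blast
  then show "weakly_converges_to x l"
    by (simp add: weakly_converges_to_def limitin_def)
qed

end

theory Submission
  imports Defs
begin

text \<open>
  For finitely many functionals and \<open>e > 0\<close>, weak compactness provides points \<open>c j\<close> of \<open>C\<close> that
  approximate all of \<open>C\<close>, and a partition of unity in the values of \<open>f\<close> turns \<open>f\<close> into a
  norm-continuous map \<open>x \<mapsto> \<Sum>p j x *\<^sub>R c j\<close>, whose fixed point (Brouwer) is moved by \<open>f\<close> by less
  than \<open>e\<close> under each functional. Hence \<open>0\<close> lies in the weak closure of the displacements
  \<open>x - f x\<close>. These lie in the weakly compact set \<open>C - C\<close>, so by Whitley's argument (which uses
  Hahn--Banach) a sequence of them converges weakly to \<open>0\<close>.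

  The dimension in Brouwer's theorem depends on the functionals, so it cannot be a type; the fixed
  point property of the Hilbert cube, obtained from Kuhn's lemma by compactness, covers all
  dimensions at once.
\<close>

subsection \<open>Dominated linear functionals\<close>

definition sublinear :: "('a::real_vector \<Rightarrow> real) \<Rightarrow> bool" where
  "sublinear q \<longleftrightarrow>
     (\<forall>x y. q (x + y) \<le> q x + q y) \<and> (\<forall>c x. 0 \<le> c \<longrightarrow> q (c *\<^sub>R x) = c * q x)"

lemma sublinear_add: "sublinear q \<Longrightarrow> q (x + y) \<le> q x + q y"
  and sublinear_scale: "sublinear q \<Longrightarrow> 0 \<le> c \<Longrightarrow> q (c *\<^sub>R x) = c * q x"
  by (auto simp: sublinear_def)

lemma sublinear_0: "sublinear q \<Longrightarrow> q 0 = 0"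
  using sublinear_scale[of q 0 0] by simp

lemma sublinear_minus: "sublinear q \<Longrightarrow> - q (- x) \<le> q x"
  using sublinear_add[of q x "- x"] by (simp add: sublinear_0)

text \<open>Applying \<open>scale\<close> to \<open>inverse c\<close> and
  \<open>c *\<^sub>R x\<close> gives the reverse inequality, so one half of positive homogeneity
  yields the other.\<close>

lemma sublinearI:
  assumes add: "\<And>x y. q (x + y) \<le> q x + q y"
    and scale: "\<And>c x. 0 < c \<Longrightarrow> q (c *\<^sub>R x) \<le> c * q x"
    and zero: "q 0 = 0"
  shows "sublinear q"
proof -
  have "q (c *\<^sub>R x) = c * q x" if "0 \<le> c" for c x
  proof (cases "c = 0")
    case False
    with that have c: "0 < c" by simp
    have "q x \<le> inverse c * q (c *\<^sub>R x)"
      using scale[of "inverse c" "c *\<^sub>R x"] c by simp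
    with c have "c * q x \<le> q (c *\<^sub>R x)" by (simp add: field_simps)
    with scale[OF c, of x] show ?thesis by simp
  qed (simp add: zero)
  with add show ?thesis unfolding sublinear_def by blast
qed

lemma sublinear_norm: "sublinear norm"
  by (rule sublinearI) (auto simp: norm_triangle_ineq)

text \<open>Lowering \<open>q\<close> as far as possible so that every functional below it exceeds \<open>h\<close> on the
  cone \<open>K\<close>: with \<open>K\<close> a ray this forces a value, with \<open>K\<close> a subspace and \<open>h = 0\<close> it is the
  quotient seminorm.\<close>

lemma sublinear_envelope:
  fixes q :: "'a::real_vector \<Rightarrow> real"
  assumes q: "sublinear q" and K0: "0 \<in> K"
    and K_add: "\<And>x y. x \<in> K \<Longrightarrow> y \<in> K \<Longrightarrow> x + y \<in> K"
    and K_scale: "\<And>c x. 0 < c \<Longrightarrow> x \<in> K \<Longrightarrow> c *\<^sub>R x \<in> K"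
    and h_add: "\<And>x y. x \<in> K \<Longrightarrow> y \<in> K \<Longrightarrow> h (x + y) = h x + h y"
    and h_scale: "\<And>c x. 0 < c \<Longrightarrow> x \<in> K \<Longrightarrow> h (c *\<^sub>R x) = c * h x"
    and h_le: "\<And>x. x \<in> K \<Longrightarrow> h x \<le> q x"
  defines "r \<equiv> \<lambda>y. INF k\<in>K. q (y + k) - h k"
  shows "sublinear r" and "r y \<le> q y" and "k \<in> K \<Longrightarrow> r (- k) \<le> - h k"
proof -
  have h0: "h 0 = 0" using h_add[OF K0 K0] by simp
  \<comment> \<open>The bound is independent of \<open>k\<close>, which makes the real-valued
    infimum \<open>r y\<close> meaningful.\<close>
  have bdd: "- q (- y) \<le> q (y + k) - h k" if "k \<in> K" for y k
    using sublinear_add[OF q, of "y + k" "- y"] h_le[OF that] by simp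
  have r_le: "r y \<le> q (y + k) - h k" if "k \<in> K" for y k
    unfolding r_def using bdd that by (intro cINF_lower) (auto intro!: bdd_belowI2)
  have r_ge: "b \<le> r y" if "\<And>k. k \<in> K \<Longrightarrow> b \<le> q (y + k) - h k" for y b
    unfolding r_def using K0 that by (intro cINF_greatest) auto
  show le: "r y \<le> q y" for y using r_le[OF K0, of y] by (simp add: h0)
  show "k \<in> K \<Longrightarrow> r (- k) \<le> - h k" for k using r_le[of k "- k"] by (simp add: sublinear_0[OF q])
  show "sublinear r"
  proof (rule sublinearI)
    fix x y
    \<comment> \<open>A competitor \<open>k\<close> for \<open>x\<close> and a competitor
      \<open>l\<close> for \<open>y\<close> add up to one for \<open>x + y\<close>; the two infima
      are then taken one after the other.\<close>
    have "r (x + y) - (q (x + k) - h k) \<le> r y" if k: "k \<in> K" for k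
    proof (rule r_ge)
      fix l assume l: "l \<in> K"
      have "r (x + y) \<le> q ((x + y) + (k + l)) - h (k + l)"
        using k l by (intro r_le K_add)
      also have "\<dots> \<le> q (x + k) + q (y + l) - (h k + h l)"
        using sublinear_add[OF q, of "x + k" "y + l"] k l by (simp add: h_add algebra_simps)
      finally show "r (x + y) - (q (x + k) - h k) \<le> q (y + l) - h l" by simp
    qed
    then have "r (x + y) - r y \<le> r x"
      by (intro r_ge) (simp add: algebra_simps)
    then show "r (x + y) \<le> r x + r y" by simp
  next
    fix c :: real and x assume c: "0 < c"
    have "r (c *\<^sub>R x) / c \<le> r x"
    proof (rule r_ge)
      fix k assume k: "k \<in> K"
      have "r (c *\<^sub>R x) \<le> q (c *\<^sub>R x + c *\<^sub>R k) - h (c *\<^sub>R k)"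
        using k c by (intro r_le K_scale)
      also have "\<dots> = c * (q (x + k) - h k)"
        using c k sublinear_scale[OF q, of c "x + k"]
        by (simp add: h_scale scaleR_add_right right_diff_distrib)
      finally show "r (c *\<^sub>R x) / c \<le> q (x + k) - h k" using c by (simp add: field_simps)
    qed
    then show "r (c *\<^sub>R x) \<le> c * r x" using c by (simp add: field_simps)
  next
    show "r 0 = 0"
      using le[of 0] r_ge[of 0 0] h_le by (intro antisym) (auto simp: sublinear_0[OF q])
  qed
qed

text \<open>This is the envelope for the ray through \<open>x\<close> with \<open>h = q\<close>,
  which is additive there. A linear functional below \<open>r\<close> is at least \<open>q x\<close>
  at \<open>x\<close>, and being below \<open>q\<close> it takes exactly that value.\<close>

lemma sublinear_ray_envelope:
  fixes q :: "'a::real_vector \<Rightarrow> real"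
  assumes q: "sublinear q"
  obtains r where "sublinear r" "\<And>y. r y \<le> q y" "r (- x) \<le> - q x"
proof -
  let ?K = "{t *\<^sub>R x | t. 0 \<le> t}"
  have add: "q (a + b) = q a + q b" if "a \<in> ?K" "b \<in> ?K" for a b
    using that by (auto simp: sublinear_scale[OF q] distrib_right simp flip: scaleR_add_left)
  have K_add: "a + b \<in> ?K" if "a \<in> ?K" "b \<in> ?K" for a b
    using that by (auto simp flip: scaleR_add_left intro: add_nonneg_nonneg)
  have K_scale: "c *\<^sub>R a \<in> ?K" if "0 < c" "a \<in> ?K" for c a
  proof -
    obtain t where "0 \<le> t" "a = t *\<^sub>R x" using \<open>a \<in> ?K\<close> by blast
    with \<open>0 < c\<close> show ?thesis by (auto intro!: exI[of _ "c * t"])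
  qed
  have x: "x \<in> ?K" by (auto intro: exI[of _ 1])
  have K0: "0 \<in> ?K" by (auto intro: exI[of _ 0])
  define r where "r = (\<lambda>y. INF k\<in>?K. q (y + k) - q k)"
  have "sublinear r" "r y \<le> q y" "k \<in> ?K \<Longrightarrow> r (- k) \<le> - q k" for y k
    unfolding r_def
    by (rule sublinear_envelope[where h = q, OF q K0 K_add K_scale add];
        use sublinear_scale[OF q] in auto)+
  with x show ?thesis by (intro that) auto
qed

text \<open>Zorn's lemma applies with the pointwise infimum of a chain as bound. The infimum is
  finite because sublinear \<open>q \<le> p\<close> satisfies
  \<open>- p (- x) \<le> q x\<close>.\<close>

lemma exists_minimal_sublinear:
  fixes p :: "'a::real_vector \<Rightarrow> real"
  assumes p: "sublinear p"
  obtains q where "sublinear q" "q \<le> p" "\<And>r. sublinear r \<Longrightarrow> r \<le> q \<Longrightarrow> r = q"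
proof -
  let ?A = "{q. sublinear q \<and> q \<le> p}"
  let ?P = "\<lambda>q r :: 'a \<Rightarrow> real. r \<le> q"
  have "\<exists>m\<in>?A. \<forall>a\<in>?A. ?P m a \<longrightarrow> a = m"
  proof (rule predicate_Zorn)
    show "partial_order_on ?A (relation_of ?P ?A)"
      by (rule partial_order_on_relation_ofI) auto
  next
    fix \<C> assume "\<C> \<in> Chains (relation_of ?P ?A)"
    then have sub: "\<And>q. q \<in> \<C> \<Longrightarrow> sublinear q" "\<And>q. q \<in> \<C> \<Longrightarrow> q \<le> p"
      and chain: "\<And>q r. q \<in> \<C> \<Longrightarrow> r \<in> \<C> \<Longrightarrow> q \<le> r \<or> r \<le> q"
      by (auto simp: Chains_def relation_of_def)
    show "\<exists>u\<in>?A. \<forall>a\<in>\<C>. ?P a u"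
    proof (cases "\<C> = {}")
      case True
      with p show ?thesis by auto
    next
      case False
      define u where "u = (\<lambda>x. INF q\<in>\<C>. q x)"
      have u_le: "u x \<le> q x" if "q \<in> \<C>" for q x
      proof -
        have "- p (- x) \<le> r x" if "r \<in> \<C>" for r
          using sublinear_minus[OF sub(1)[OF that], of x] sub(2)[OF that]
          by (meson le_funD neg_le_iff_le order_trans)
        then show ?thesis unfolding u_def
          using that by (intro cINF_lower) (auto intro!: bdd_belowI2)
      qed
      have u_ge: "b \<le> u x" if "\<And>q. q \<in> \<C> \<Longrightarrow> b \<le> q x" for b x
        unfolding u_def using False that by (intro cINF_greatest) auto
      have "sublinear u"
      proof (rule sublinearI)
        fix x y
        have "u (x + y) - q x \<le> u y" if q: "q \<in> \<C>" for q
        proof (rule u_ge)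
          fix r assume r: "r \<in> \<C>"
          \<comment> \<open>The smaller of \<open>q\<close> and \<open>r\<close> can be used at both
            arguments, so subadditivity of a single function suffices.\<close>
          from chain[OF q r] show "u (x + y) - q x \<le> r y"
          proof
            assume "q \<le> r"
            with u_le[OF q, of "x + y"] sublinear_add[OF sub(1)[OF q], of x y] show ?thesis
              by (auto dest!: le_funD[of _ _ y])
          next
            assume "r \<le> q"
            with u_le[OF r, of "x + y"] sublinear_add[OF sub(1)[OF r], of x y] show ?thesis
              by (auto dest!: le_funD[of _ _ x])
          qed
        qed
        then have "u (x + y) - u y \<le> u x" by (intro u_ge) (simp add: algebra_simps)
        then show "u (x + y) \<le> u x + u y" by simp
      next
        fix c :: real and x assume c: "0 < c"
        have "u (c *\<^sub>R x) / c \<le> u x"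
          using u_le[of _ "c *\<^sub>R x"] c sub(1)
          by (intro u_ge) (simp add: field_simps sublinear_scale[symmetric])
        with c show "u (c *\<^sub>R x) \<le> c * u x" by (simp add: field_simps)
      next
        show "u 0 = 0" using False sub(1) by (simp add: u_def sublinear_0)
      qed
      moreover have "u \<le> p" using False u_le sub(2) by (meson ex_in_conv le_funI le_funD order_trans)
      ultimately show ?thesis using u_le by (auto simp: le_fun_def)
    qed
  qed
  then show ?thesis using that by (auto intro: order_trans)
qed

text \<open>A minimal sublinear functional is odd, since no ray envelope can lie strictly below it,
  and an odd sublinear functional is linear.\<close>

lemma Hahn_Banach_sublinear:
  fixes p :: "'a::real_vector \<Rightarrow> real"
  assumes p: "sublinear p"
  obtains \<phi> where "linear \<phi>" "\<And>x. \<phi> x \<le> p x" "\<phi> x\<^sub>0 = p x\<^sub>0"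
proof -
  \<comment> \<open>Lowering \<open>p\<close> along the ray before minimising forces the prescribed
    value at \<open>x\<^sub>0\<close>.\<close>
  obtain p' where p': "sublinear p'" "\<And>y. p' y \<le> p y" "p' (- x\<^sub>0) \<le> - p x\<^sub>0"
    using sublinear_ray_envelope[OF p, of x\<^sub>0] by blast
  obtain q where q: "sublinear q" "q \<le> p'" and
    min: "\<And>r. sublinear r \<Longrightarrow> r \<le> q \<Longrightarrow> r = q"
    using exists_minimal_sublinear[OF p'(1)] by blast
  have neg: "q (- x) = - q x" for x
  proof -
    obtain r where r: "sublinear r" "\<And>y. r y \<le> q y" "r (- x) \<le> - q x"
      using sublinear_ray_envelope[OF q(1), of x] by blast
    then have "r = q" by (intro min) (auto simp: le_fun_def)
    with r(3) sublinear_minus[OF q(1), of x] show ?thesis by simp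
  qed
  have "linear q"
  proof (rule linearI)
    fix x y
    have "q (- x + - y) \<le> q (- x) + q (- y)" by (rule sublinear_add[OF q(1)])
    then have "q x + q y \<le> q (x + y)" using neg[of "x + y"] by (simp add: neg)
    with sublinear_add[OF q(1), of x y] show "q (x + y) = q x + q y" by simp
  next
    fix c x
    show "q (c *\<^sub>R x) = c *\<^sub>R q x"
    proof (cases "0 \<le> c")
      case False
      then have "q ((- c) *\<^sub>R x) = (- c) * q x" by (intro sublinear_scale[OF q(1)]) simp
      then show ?thesis using neg[of "c *\<^sub>R x"] by simp
    qed (simp add: sublinear_scale[OF q(1)])
  qed
  moreover have le: "q x \<le> p x" for x using q(2) p'(2)[of x] by (meson le_funD order_trans)
  moreover have "q x\<^sub>0 = p x\<^sub>0"
    using le[of x\<^sub>0] q(2) p'(3) neg[of x\<^sub>0] by (auto dest!: le_funD[of _ _ "- x\<^sub>0"])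
  ultimately show ?thesis by (rule that)
qed

section \<open>Norming and separating functionals\<close>

lemma bounded_linear_le_norm:
  fixes \<phi> :: "'a::real_normed_vector \<Rightarrow> real"
  assumes "linear \<phi>" and le: "\<And>x. \<phi> x \<le> norm x"
  shows "bounded_linear \<phi>" and "\<bar>\<phi> x\<bar> \<le> norm x"
proof -
  show *: "\<bar>\<phi> x\<bar> \<le> norm x" for x
    using le[of x] le[of "- x"] linear_neg[OF assms(1), of x] by simp
  show "bounded_linear \<phi>"
    using assms(1) * by (intro bounded_linear_intro[where K = 1]) (auto simp: linear_iff)
qed

lemma exists_norming_functional:
  fixes x :: "'a::real_normed_vector"
  obtains \<phi> where "bounded_linear \<phi>" "\<And>y. \<bar>\<phi> y\<bar> \<le> norm y" "\<phi> x = norm x"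
  using Hahn_Banach_sublinear[OF sublinear_norm, of x] bounded_linear_le_norm by metis

text \<open>The envelope over \<open>S\<close> with \<open>h = 0\<close> is the distance to
  \<open>S\<close>, which is positive at \<open>z\<close>. A linear functional below it is
  nonpositive on the subspace \<open>S\<close>, hence zero there.\<close>

lemma separate_point_from_subspace:
  fixes z :: "'a::real_normed_vector"
  assumes S: "subspace S" and z: "z \<notin> closure S"
  obtains \<phi> :: "'a \<Rightarrow> real"
    where "bounded_linear \<phi>" "\<And>s. s \<in> S \<Longrightarrow> \<phi> s = 0" "\<phi> z \<noteq> 0"
proof -
  \<comment> \<open>The term \<open>- 0\<close> keeps the shape of the envelope formula with
    \<open>h = 0\<close>.\<close>
  define r where "r = (\<lambda>y. INF k\<in>S. norm (y + k) - 0)"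
  have r: "sublinear r" and r_le: "r y \<le> norm y" and r_S: "k \<in> S \<Longrightarrow> r (- k) \<le> - 0" for y k
    unfolding r_def
    by (rule sublinear_envelope[OF sublinear_norm]; use S in \<open>auto simp: subspace_def\<close>)+
  obtain \<phi> where \<phi>: "linear \<phi>" "\<And>x. \<phi> x \<le> r x" "\<phi> z = r z"
    using Hahn_Banach_sublinear[OF r, of z] by blast
  have le: "\<phi> s \<le> 0" if "s \<in> S" for s
    using r_S[of "- s"] \<phi>(2)[of s] that S by (simp add: subspace_neg)
  have "\<phi> s = 0" if "s \<in> S" for s
    using le[OF that] le[of "- s"] that S linear_neg[OF \<phi>(1), of s] by (simp add: subspace_neg)
  moreover have "bounded_linear \<phi>"
    using \<phi>(1,2) r_le by (intro bounded_linear_le_norm(1)) (auto intro: order_trans)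
  moreover have "r z \<noteq> 0"
  proof -
    obtain e where e: "0 < e" "\<And>y. y \<in> S \<Longrightarrow> e \<le> dist y z"
        using z by (force simp: closure_approachable)
    have "e \<le> norm (z + k) - 0" if "k \<in> S" for k
      using e(2)[of "- k"] that S by (simp add: subspace_neg dist_norm norm_minus_commute)
    then have "e \<le> r z" unfolding r_def using S by (intro cINF_greatest) (auto simp: subspace_def)
    with e(1) show ?thesis by simp
  qed
  ultimately show ?thesis using that \<phi>(3) by auto
qed

subsection \<open>The fixed point property of the Hilbert cube\<close>

definition hilbert_cube :: "(nat \<Rightarrow> real) set" where
  "hilbert_cube = {t. \<forall>i. t i \<in> {0..1}}"

lemma compact_hilbert_cube: "compact hilbert_cube"
proof -
  have "compactin (product_topology (\<lambda>_::nat. euclideanreal) UNIV) (PiE UNIV (\<lambda>_. {0..1}))"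
    by (simp add: compactin_PiE)
  moreover have "PiE UNIV (\<lambda>_. {0..1}) = hilbert_cube"
    by (auto simp: hilbert_cube_def PiE_UNIV_domain)
  ultimately show ?thesis by (simp add: euclidean_product_topology)
qed

lemma tendsto_fun_iff:
  fixes X :: "nat \<Rightarrow> nat \<Rightarrow> real"
  shows "X \<longlonglongrightarrow> t \<longleftrightarrow> (\<forall>i. (\<lambda>k. X k i) \<longlonglongrightarrow> t i)"
proof -
  have "X \<longlonglongrightarrow> t \<longleftrightarrow> limitin (product_topology (\<lambda>_. euclidean) UNIV) X t sequentially"
    by (simp add: euclidean_product_topology)
  also have "\<dots> \<longleftrightarrow> (\<forall>i. (\<lambda>k. X k i) \<longlonglongrightarrow> t i)"
    by (subst limitin_componentwise) auto
  finally show ?thesis .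
qed

text \<open>Kuhn's lemma for the subdivision of the first \<open>k\<close> coordinates into \<open>k\<close> parts each.\<close>

lemma hilbert_cube_kuhn:
  assumes g: "g \<in> hilbert_cube \<rightarrow> hilbert_cube" and k: "0 < k"
  shows "\<exists>t\<in>hilbert_cube. \<forall>i<k. \<exists>u\<in>hilbert_cube. \<exists>v\<in>hilbert_cube.
    (\<forall>j. \<bar>u j - t j\<bar> \<le> 1 / real k) \<and> (\<forall>j. \<bar>v j - t j\<bar> \<le> 1 / real k) \<and>
    u i \<le> g u i \<and> g v i \<le> v i"
proof -
  define pt where "pt x = (\<lambda>j. if j < k then real (x j) / real k else 0)" for x :: "nat \<Rightarrow> nat"
  \<comment> \<open>Label 1 records that \<open>g\<close> does not raise coordinate
    \<open>i\<close>. Kuhn's boundary conditions hold: the label is set to 0 where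
    \<open>x i = 0\<close>, and it is 1 where \<open>x i = k\<close> because \<open>g\<close> is at
    most 1.\<close>
  define label where
    "label x i = (if x i \<noteq> 0 \<and> g (pt x) i \<le> pt x i then 1 else 0 :: nat)" for x i
  have pt: "pt x \<in> hilbert_cube" if "\<And>i. i < k \<Longrightarrow> x i \<le> k" for x
    using that k by (auto simp: pt_def hilbert_cube_def)
  have g01: "0 \<le> g t i" "g t i \<le> 1" if "t \<in> hilbert_cube" for t i
    using funcset_mem[OF g that] by (auto simp: hilbert_cube_def)
  obtain q where q: "\<forall>i<k. q i < k" and
    rs: "\<forall>i<k. \<exists>r s. (\<forall>j<k. q j \<le> r j \<and> r j \<le> q j + 1) \<and>
      (\<forall>j<k. q j \<le> s j \<and> s j \<le> q j + 1) \<and> label r i \<noteq> label s i"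
  proof (rule kuhn_lemma[of k k label])
    show "\<forall>x. (\<forall>i<k. x i \<le> k) \<longrightarrow> (\<forall>i<k. x i = k \<longrightarrow> label x i = 1)"
      using g01 pt k by (auto simp: label_def pt_def)
  qed (use k in \<open>auto simp: label_def\<close>)
  have near: "pt r \<in> hilbert_cube \<and> (\<forall>j. \<bar>pt r j - pt q j\<bar> \<le> 1 / real k)"
    if r: "\<forall>j<k. q j \<le> r j \<and> r j \<le> q j + 1" for r
  proof
    have "r j \<le> k" if "j < k" for j
      using r[rule_format, OF that] q[rule_format, OF that] by linarith
    then show "pt r \<in> hilbert_cube" by (rule pt)
    have "\<bar>real (r j) - real (q j)\<bar> \<le> 1" if "j < k" for j
      using r[rule_format, OF that] by linarith
    then show "\<forall>j. \<bar>pt r j - pt q j\<bar> \<le> 1 / real k"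
      using k by (auto simp: pt_def divide_right_mono simp flip: diff_divide_distrib)
  qed
  \<comment> \<open>Where label 0 was imposed on the face, the coordinate is 0 and the inequality
    follows from \<open>g\<close> being nonnegative.\<close>
  have low: "pt r i \<le> g (pt r) i" if "label r i = 0" "pt r \<in> hilbert_cube" for r i
    using that g01[of "pt r" i] by (auto simp: label_def pt_def split: if_splits)
  have high: "g (pt r) i \<le> pt r i" if "label r i \<noteq> 0" for r i
    using that by (auto simp: label_def split: if_splits)
  show ?thesis
  proof (rule bexI[of _ "pt q"], intro allI impI)
    show "pt q \<in> hilbert_cube" by (rule pt) (use q less_imp_le in blast)
    fix i assume "i < k"
    with rs obtain r s where r: "\<forall>j<k. q j \<le> r j \<and> r j \<le> q j + 1"
      and s: "\<forall>j<k. q j \<le> s j \<and> s j \<le> q j + 1" and ne: "label r i \<noteq> label s i" by blast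
    \<comment> \<open>The vertex labelled 0 becomes \<open>u\<close> and the other one becomes
      \<open>v\<close>.\<close>
    consider "label r i = 0" "label s i \<noteq> 0" | "label s i = 0" "label r i \<noteq> 0"
      using ne by (auto simp: label_def split: if_splits)
    then show "\<exists>u\<in>hilbert_cube. \<exists>v\<in>hilbert_cube.
      (\<forall>j. \<bar>u j - pt q j\<bar> \<le> 1 / real k) \<and> (\<forall>j. \<bar>v j - pt q j\<bar> \<le> 1 / real k) \<and>
      u i \<le> g u i \<and> g v i \<le> v i"
      by cases (use near[OF r] near[OF s] low high in blast)+
  qed
qed

text \<open>Near \<open>T k\<close> there are points where \<open>g\<close> does not lower
  coordinate \<open>i\<close> and points where it does not raise it. Along a convergent subsequence
  both kinds tend to the same limit \<open>t\<close>, and continuity gives both inequalities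
  there.\<close>

theorem hilbert_cube_fixed_point:
  assumes cont: "continuous_on hilbert_cube g" and g: "g \<in> hilbert_cube \<rightarrow> hilbert_cube"
  obtains t where "t \<in> hilbert_cube" "g t = t"
proof -
  have "\<exists>t\<in>hilbert_cube. \<forall>i<Suc k. \<exists>u\<in>hilbert_cube. \<exists>v\<in>hilbert_cube.
    (\<forall>j. \<bar>u j - t j\<bar> \<le> 1 / real (Suc k)) \<and> (\<forall>j. \<bar>v j - t j\<bar> \<le> 1 / real (Suc k)) \<and>
    u i \<le> g u i \<and> g v i \<le> v i" for k
    by (rule hilbert_cube_kuhn[OF g]) simp
  then obtain T where T: "\<And>k. T k \<in> hilbert_cube" and
    TUV: "\<And>k i. i < Suc k \<Longrightarrow> \<exists>u\<in>hilbert_cube. \<exists>v\<in>hilbert_cube.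
    (\<forall>j. \<bar>u j - T k j\<bar> \<le> 1 / real (Suc k)) \<and> (\<forall>j. \<bar>v j - T k j\<bar> \<le> 1 / real (Suc k)) \<and>
    u i \<le> g u i \<and> g v i \<le> v i"
    by metis
  obtain t \<sigma> where t: "t \<in> hilbert_cube" and \<sigma>: "strict_mono \<sigma>" and lim: "(T \<circ> \<sigma>) \<longlonglongrightarrow> t"
    using compact_imp_seq_compact[OF compact_hilbert_cube] T unfolding seq_compact_def by metis
  have "g t i = t i" for i
  proof -
    \<comment> \<open>The guard \<open>i \<le> k\<close> sits inside the existential so that choice
      yields total sequences; their values for \<open>k < i\<close> are arbitrary and do not affect
      the limit.\<close>
    have "\<exists>u v. i \<le> k \<longrightarrow> u \<in> hilbert_cube \<and> v \<in> hilbert_cube \<and>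
      (\<forall>j. \<bar>u j - T k j\<bar> \<le> 1 / real (Suc k)) \<and> (\<forall>j. \<bar>v j - T k j\<bar> \<le> 1 / real (Suc k)) \<and>
      u i \<le> g u i \<and> g v i \<le> v i" for k
      using TUV[of i k] by (auto simp: less_Suc_eq_le)
    then obtain U V where UV: "\<And>k. i \<le> k \<Longrightarrow> U k \<in> hilbert_cube \<and> V k \<in> hilbert_cube \<and>
      (\<forall>j. \<bar>U k j - T k j\<bar> \<le> 1 / real (Suc k)) \<and> (\<forall>j. \<bar>V k j - T k j\<bar> \<le> 1 / real (Suc k)) \<and>
      U k i \<le> g (U k) i \<and> g (V k) i \<le> V k i"
      by metis
    have large: "\<forall>\<^sub>F m in sequentially. i \<le> \<sigma> m"
      using \<sigma> by (meson eventually_sequentiallyI order_trans seq_suble)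
    have zero: "(\<lambda>m. 1 / real (Suc (\<sigma> m))) \<longlonglongrightarrow> 0"
      using LIMSEQ_subseq_LIMSEQ[OF LIMSEQ_inverse_real_of_nat \<sigma>]
      by (simp add: o_def inverse_eq_divide)
    have conv: "W \<longlonglongrightarrow> t \<and> (\<lambda>m. g (W m) i) \<longlonglongrightarrow> g t i"
      if W: "\<forall>\<^sub>F m in sequentially. W m \<in> hilbert_cube \<and>
        (\<forall>j. \<bar>W m j - T (\<sigma> m) j\<bar> \<le> 1 / real (Suc (\<sigma> m)))" for W
    proof -
      have "(\<lambda>m. W m j) \<longlonglongrightarrow> t j" for j
      proof -
        have "(\<lambda>m. W m j - T (\<sigma> m) j) \<longlonglongrightarrow> 0"
          by (rule Lim_null_comparison[OF _ zero]) (use W in \<open>auto elim: eventually_mono\<close>)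
        moreover have "(\<lambda>m. T (\<sigma> m) j) \<longlonglongrightarrow> t j"
          using lim by (simp add: tendsto_fun_iff o_def)
        ultimately show ?thesis using tendsto_add by fastforce
      qed
      then have Wt: "W \<longlonglongrightarrow> t" by (simp add: tendsto_fun_iff)
      have "\<forall>\<^sub>F m in sequentially. W m \<in> hilbert_cube" using W by (auto elim: eventually_mono)
      then have "(\<lambda>m. g (W m)) \<longlonglongrightarrow> g t"
        using continuous_on_tendsto_compose[OF cont Wt t] by simp
      with Wt show ?thesis by (simp add: tendsto_fun_iff)
    qed
    have U: "(\<lambda>m. U (\<sigma> m)) \<longlonglongrightarrow> t \<and> (\<lambda>m. g (U (\<sigma> m)) i) \<longlonglongrightarrow> g t i"
      by (rule conv, rule eventually_mono[OF large]) (use UV in blast)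
    have V: "(\<lambda>m. V (\<sigma> m)) \<longlonglongrightarrow> t \<and> (\<lambda>m. g (V (\<sigma> m)) i) \<longlonglongrightarrow> g t i"
      by (rule conv, rule eventually_mono[OF large]) (use UV in blast)
    have "t i \<le> g t i"
      by (rule tendsto_le[of sequentially "\<lambda>m. g (U (\<sigma> m)) i" _ "\<lambda>m. U (\<sigma> m) i"])
        (use U UV large in \<open>auto simp: tendsto_fun_iff elim: eventually_mono\<close>)
    moreover have "g t i \<le> t i"
      by (rule tendsto_le[of sequentially "\<lambda>m. V (\<sigma> m) i" _ "\<lambda>m. g (V (\<sigma> m)) i"])
        (use V UV large in \<open>auto simp: tendsto_fun_iff elim: eventually_mono\<close>)
    ultimately show ?thesis by simp
  qed
  with t show ?thesis by (intro that) auto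
qed

subsection \<open>Approximate fixed points for finitely many functionals\<close>

text \<open>The problem is moved to a cube of coefficients: \<open>t\<close> is normalised by
  \<open>w\<close>, sent to the point \<open>s t\<close> of \<open>C\<close>, and then to the values
  \<open>p j (s t)\<close>. A fixed coefficient vector \<open>t\<close> yields the point
  \<open>s t\<close>.\<close>

lemma partition_of_unity_fixed_point:
  fixes c :: "nat \<Rightarrow> 'a::real_normed_vector" and p :: "nat \<Rightarrow> 'a \<Rightarrow> real"
  assumes C: "convex C" and c: "\<And>j. j < m \<Longrightarrow> c j \<in> C" and m: "0 < m"
    and cont: "\<And>j. j < m \<Longrightarrow> continuous_on C (p j)"
    and nonneg: "\<And>j x. j < m \<Longrightarrow> x \<in> C \<Longrightarrow> 0 \<le> p j x"
    and sum1: "\<And>x. x \<in> C \<Longrightarrow> (\<Sum>j<m. p j x) = 1"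
  obtains x where "x \<in> C" "x = (\<Sum>j<m. p j x *\<^sub>R c j)"
proof -
  define \<Sigma> where "\<Sigma> t = (\<Sum>j<m. t j)" for t :: "nat \<Rightarrow> real"
  define w where "w t j = (t j + (if j = 0 then max 0 (1 - \<Sigma> t) else 0)) / max 1 (\<Sigma> t)" for t j
  \<comment> \<open>\<open>w\<close> retracts the cube onto the simplex: \<open>w t = t\<close> on the first \<open>m\<close> coordinates if they sum
    to \<open>1\<close>.\<close>
  define s where "s t = (\<Sum>j<m. w t j *\<^sub>R c j)" for t
  define g where "g t = (\<lambda>j. if j < m then p j (s t) else 0)" for t
  have w1: "(\<Sum>j<m. w t j) = 1" for t
  proof -
    \<comment> \<open>Coordinate 0 alone absorbs a deficit \<open>1 - \<Sigma> t\<close>, and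
      \<open>0 < m\<close> puts it among the summed ones; the division removes an excess.\<close>
    have "(\<Sum>j<m. w t j) = (\<Sigma> t + max 0 (1 - \<Sigma> t)) / max 1 (\<Sigma> t)"
      using m by (simp add: w_def \<Sigma>_def sum.distrib sum.delta flip: sum_divide_distrib)
    also have "\<Sigma> t + max 0 (1 - \<Sigma> t) = max 1 (\<Sigma> t)" by auto
    finally show ?thesis by (simp add: max_def)
  qed
  have s: "s t \<in> C" if "t \<in> hilbert_cube" for t
    unfolding s_def
  proof (rule convex_sum[OF _ C w1])
    show "0 \<le> w t i" for i using that by (auto simp: w_def hilbert_cube_def)
  qed (use c in auto)
  have le1: "p j x \<le> 1" if "j < m" "x \<in> C" for j x
    using member_le_sum[of j "{..<m}" "\<lambda>j. p j x"] sum1[OF that(2)] nonneg that by auto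
  have coord: "continuous_on hilbert_cube (\<lambda>t. t j)" for j
    by (rule continuous_on_subset[OF continuous_on_product_coordinates]) simp
  have \<Sigma>: "continuous_on hilbert_cube \<Sigma>"
    unfolding \<Sigma>_def by (intro continuous_intros coord)
  have "continuous_on hilbert_cube (\<lambda>t. w t j)" for j
  proof -
    have "continuous_on hilbert_cube (\<lambda>t. if j = 0 then max 0 (1 - \<Sigma> t) else 0)"
      by (cases "j = 0") (auto intro!: continuous_intros \<Sigma>)
    then show ?thesis
      unfolding w_def by (intro continuous_intros coord \<Sigma>) (auto simp: max_def)
  qed
  then have "continuous_on hilbert_cube s"
    unfolding s_def by (intro continuous_intros)
  then have "continuous_on hilbert_cube (\<lambda>t. g t j)" for j
    using s by (cases "j < m") (auto simp: g_def intro: continuous_on_compose2[OF cont])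
  then have "continuous_on hilbert_cube g"
    by (rule continuous_on_coordinatewise_then_product)
  moreover have "g \<in> hilbert_cube \<rightarrow> hilbert_cube"
    using s nonneg le1 by (auto simp: g_def hilbert_cube_def)
  ultimately obtain t where t: "t \<in> hilbert_cube" and fixp: "g t = t"
    by (rule hilbert_cube_fixed_point)
  have tj: "t j = p j (s t)" if "j < m" for j
    using fun_cong[OF fixp, of j] that by (simp add: g_def)
  \<comment> \<open>At the fixed point the coordinates are values of a partition of unity, so the
    normalisation \<open>w\<close> leaves them unchanged.\<close>
  then have "\<Sigma> t = 1" using sum1[OF s[OF t]] by (simp add: \<Sigma>_def)
  then have "w t j = t j" for j by (simp add: w_def)
  then have "s t = (\<Sum>j<m. p j (s t) *\<^sub>R c j)"
    by (subst s_def) (simp add: tj)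
  with s[OF t] show ?thesis by (rule that)
qed

section \<open>Weak neighbourhoods and the Schauder projection\<close>

lemma openin_weak_topology:
  fixes \<phi> :: "'a::real_normed_vector \<Rightarrow> real"
  assumes "bounded_linear \<phi>" "open U"
  shows "openin weak_topology (\<phi> -` U)"
  unfolding weak_topology_def by (rule topology_generated_by_Basis) (use assms in blast)

lemma openin_weak_topology_ball:
  fixes y :: "'a::real_normed_vector"
  assumes "finite Q" and Q: "\<And>\<phi>. \<phi> \<in> Q \<Longrightarrow> bounded_linear (\<phi> :: 'a \<Rightarrow> real)"
  shows "openin weak_topology {x. \<forall>\<phi>\<in>Q. \<bar>\<phi> x - \<phi> y\<bar> < e}"
proof (cases "Q = {}")
  case True
  then show ?thesis using openin_topspace[of "weak_topology :: 'a topology"] by simp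
next
  case False
  have "openin weak_topology (\<Inter>\<phi>\<in>Q. \<phi> -` ball (\<phi> y) e)"
    using assms False by (intro openin_INT2 openin_weak_topology) auto
  also have "(\<Inter>\<phi>\<in>Q. \<phi> -` ball (\<phi> y) e) = {x. \<forall>\<phi>\<in>Q. \<bar>\<phi> x - \<phi> y\<bar> < e}"
    by (auto simp: dist_real_def abs_minus_commute)
  finally show ?thesis .
qed

text \<open>Norm continuity on \<open>C\<close> can be tested on sequences, and weak convergence is
  convergence under each bounded functional.\<close>

lemma demicontinuous_on_imp_continuous_on:
  fixes f :: "'a::real_normed_vector \<Rightarrow> 'a" and \<phi> :: "'a \<Rightarrow> real"
  assumes "demicontinuous_on C f" "bounded_linear \<phi>"
  shows "continuous_on C (\<lambda>x. \<phi> (f x))"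
  using assms unfolding continuous_on_sequentially demicontinuous_on_def weakly_converges_to_iff
  by (auto simp: o_def)

text \<open>A fixed point of the Schauder projection composed with \<open>f\<close> is a convex
  combination of those \<open>c j\<close> whose distance \<open>D\<close> from \<open>f x\<close> is
  below \<open>e\<close>, so each functional moves by less than \<open>e\<close>.\<close>

lemma finite_functionals_approximate_fixed_point:
  fixes C :: "'a::real_normed_vector set" and f :: "'a \<Rightarrow> 'a"
  assumes ne: "C \<noteq> {}" and comp: "weakly_compact C" and conv: "convex C"
    and f: "f \<in> C \<rightarrow> C" and demi: "demicontinuous_on C f"
    and fin: "finite Q" and Q: "\<And>\<phi>. \<phi> \<in> Q \<Longrightarrow> bounded_linear (\<phi> :: 'a \<Rightarrow> real)" and e: "0 < e"
  obtains x where "x \<in> C" "\<And>\<phi>. \<phi> \<in> Q \<Longrightarrow> \<bar>\<phi> (x - f x)\<bar> < e"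
proof -
  \<comment> \<open>With this radius the sum \<open>D\<close> of \<open>card Q\<close> terms stays
    strictly below \<open>e\<close>; the \<open>+ 1\<close> also covers empty
    \<open>Q\<close>.\<close>
  define N where "N c = {x. \<forall>\<phi>\<in>Q. \<bar>\<phi> x - \<phi> c\<bar> < e / (card Q + 1)}" for c
  obtain \<F> where \<F>: "finite \<F>" "\<F> \<subseteq> N ` C" "C \<subseteq> \<Union>\<F>"
  proof -
    have "\<forall>U \<in> N ` C. openin weak_topology U"
      using openin_weak_topology_ball[OF fin Q] by (auto simp: N_def)
    moreover have "C \<subseteq> \<Union>(N ` C)" using e by (auto simp: N_def)
    ultimately show ?thesis using comp that unfolding weakly_compact_def compactin_def by metis
  qed
  obtain T where "T \<subseteq> C" "finite T" "\<F> = N ` T"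
    using finite_subset_image[OF \<F>(1,2)] by blast
  with \<F>(3) have T: "finite T" "T \<subseteq> C" "C \<subseteq> \<Union>(N ` T)" by auto
  obtain c where c: "bij_betw c {..<card T} T"
    using ex_bij_betw_nat_finite[OF T(1)] unfolding atLeast0LessThan by blast
  define m where "m = card T"
  have m: "0 < m" using T(1,3) ne unfolding m_def card_gt_0_iff by blast
  have cC: "c j \<in> C" if "j < m" for j using bij_betwE[OF c] that T(2) unfolding m_def by blast
  define D where "D x y = (\<Sum>\<phi>\<in>Q. \<bar>\<phi> x - \<phi> y\<bar>)" for x y
  have cover: "\<exists>j<m. D x (c j) < e" if x: "x \<in> C" for x
  proof -
    obtain y where "y \<in> T" "x \<in> N y" using x T(3) by blast
    moreover obtain j where "j < m" "y = c j"
      using \<open>y \<in> T\<close> bij_betw_imp_surj_on[OF c] unfolding m_def by (metis imageE lessThan_iff)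
    ultimately have j: "j < m" "x \<in> N (c j)" by simp_all
    have "D x (c j) \<le> card Q * (e / (card Q + 1))"
      unfolding D_def using j(2) by (intro sum_bounded_above) (auto simp: N_def less_imp_le)
    also have "\<dots> < e" using e by (simp add: field_simps)
    finally show ?thesis using j(1) by blast
  qed
  \<comment> \<open>A hat function, positive exactly when \<open>c j\<close> is closer than
    \<open>e\<close> to \<open>f x\<close>; dividing by the sum gives the partition of unity
    \<open>p\<close>.\<close>
  define u where "u j x = max 0 (e - D (f x) (c j))" for j x
  define p where "p j x = u j x / (\<Sum>i<m. u i x)" for j x
  have pos: "0 < (\<Sum>i<m. u i x)" if x: "x \<in> C" for x
  proof -
    obtain j where j: "j < m" "D (f x) (c j) < e" using cover[of "f x"] f x by auto
    then show ?thesis by (intro sum_pos2[of _ j]) (auto simp: u_def)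
  qed
  have u_cont: "continuous_on C (u j)" for j
    unfolding u_def D_def
    by (intro continuous_intros demicontinuous_on_imp_continuous_on[OF demi] Q)
  obtain x where x: "x \<in> C" and xp: "x = (\<Sum>j<m. p j x *\<^sub>R c j)"
  proof (rule partition_of_unity_fixed_point[OF conv cC m])
    show "continuous_on C (p j)" for j
      unfolding p_def by (intro continuous_intros u_cont) (use pos in force)
    show "0 \<le> p j x" if "x \<in> C" for j x
      unfolding p_def by (intro divide_nonneg_nonneg sum_nonneg) (auto simp: u_def)
    show "(\<Sum>j<m. p j x) = 1" if "x \<in> C" for x
      using pos[OF that] by (simp add: p_def flip: sum_divide_distrib)
  qed blast
  have p0: "0 \<le> p j x" for j
    unfolding p_def by (intro divide_nonneg_nonneg sum_nonneg) (auto simp: u_def)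
  have p1: "(\<Sum>j<m. p j x) = 1" using pos[OF x] by (simp add: p_def flip: sum_divide_distrib)
  have "\<bar>\<phi> (x - f x)\<bar> < e" if \<phi>: "\<phi> \<in> Q" for \<phi>
  proof -
    interpret bounded_linear \<phi> by (rule Q[OF \<phi>])
    have close: "\<bar>\<phi> (c j - f x)\<bar> < e" if "p j x \<noteq> 0" for j
    proof -
      have "\<bar>\<phi> (f x) - \<phi> (c j)\<bar> \<le> D (f x) (c j)"
        unfolding D_def by (rule member_le_sum[OF \<phi> _ fin]) simp
      also have "\<dots> < e" using that by (auto simp: p_def u_def max_def split: if_splits)
      finally show ?thesis by (simp add: diff abs_minus_commute)
    qed
    have "x - f x = (\<Sum>j<m. p j x *\<^sub>R (c j - f x))"
      using p1 by (subst xp) (simp add: scaleR_diff_right sum_subtractf flip: scaleR_left.sum)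
    then have "\<phi> (x - f x) = (\<Sum>j<m. p j x * \<phi> (c j - f x))" by (simp add: sum scaleR)
    also have "\<bar>\<dots>\<bar> \<le> (\<Sum>j<m. p j x * \<bar>\<phi> (c j - f x)\<bar>)"
      using p0 by (intro order_trans[OF sum_abs]) (simp add: abs_mult)
    also have "\<dots> < (\<Sum>j<m. p j x * e)"
    proof -
      \<comment> \<open>Terms with zero weight give only equality, so strictness comes from one
        nonzero weight.\<close>
      obtain i where i: "i < m" "p i x \<noteq> 0" using p1 by (metis lessThan_iff sum.neutral zero_neq_one)
      show ?thesis
      proof (rule sum_strict_mono_ex1)
        show "\<forall>j\<in>{..<m}. p j x * \<bar>\<phi> (c j - f x)\<bar> \<le> p j x * e"
        proof
          fix j show "p j x * \<bar>\<phi> (c j - f x)\<bar> \<le> p j x * e"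
            by (cases "p j x = 0") (use close[of j] p0[of j] in \<open>auto intro!: mult_left_mono\<close>)
        qed
        show "\<exists>j\<in>{..<m}. p j x * \<bar>\<phi> (c j - f x)\<bar> < p j x * e"
          using i close[OF i(2)] p0[of i] by (intro bexI[of _ i]) auto
      qed simp
    qed
    also have "\<dots> = e" using p1 by (simp flip: sum_distrib_right)
    finally show ?thesis .
  qed
  with x show ?thesis by (rule that)
qed

subsection \<open>Weakly null sequences\<close>

text \<open>Continuity into a generated topology is tested on generators; there linearity of
  \<open>\<phi>\<close> leaves a difference of two continuous real functions.\<close>

lemma continuous_map_weak_topology_diff:
  "continuous_map (prod_topology weak_topology weak_topology) weak_topology
    (\<lambda>z. fst z - snd z :: 'a::real_normed_vector)" (is "continuous_map ?P _ ?d")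
proof -
  let ?S = "{\<phi> -` U | (\<phi> :: 'a \<Rightarrow> real) U. bounded_linear \<phi> \<and> open U}"
  have "continuous_map ?P (topology_generated_by ?S) ?d"
  proof (rule continuous_on_generated_topo)
    fix V assume "V \<in> ?S"
    then obtain \<phi> :: "'a \<Rightarrow> real" and U where
      V: "V = \<phi> -` U" and \<phi>: "bounded_linear \<phi>" and U: "open U" by blast
    have c: "continuous_map weak_topology euclideanreal \<phi>"
      using openin_weak_topology[OF \<phi>] by (simp add: continuous_map_def vimage_def)
    have "continuous_map ?P euclideanreal (\<lambda>z. \<phi> (fst z))"
      using continuous_map_compose[OF continuous_map_fst c] by (simp add: o_def)
    moreover have "continuous_map ?P euclideanreal (\<lambda>z. \<phi> (snd z))"
      using continuous_map_compose[OF continuous_map_snd c] by (simp add: o_def)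
    ultimately have "continuous_map ?P euclideanreal (\<lambda>z. \<phi> (fst z) - \<phi> (snd z))"
      by (rule continuous_map_diff)
    then have "openin ?P {z \<in> topspace ?P. \<phi> (fst z) - \<phi> (snd z) \<in> U}"
      by (rule openin_continuous_map_preimage) (use U in simp)
    also have "{z \<in> topspace ?P. \<phi> (fst z) - \<phi> (snd z) \<in> U} = ?d -` V \<inter> topspace ?P"
      using linear_diff[OF bounded_linear.linear[OF \<phi>]] by (auto simp: V)
    finally show "openin ?P (?d -` V \<inter> topspace ?P)" .
  next
    show "?d ` topspace ?P \<subseteq> \<Union> ?S"
      using topspace_weak_topology[where 'a = 'a]
      unfolding weak_topology_def topology_generated_by_topspace by simp
  qed
  then show ?thesis unfolding weak_topology_def .
qed

lemma weakly_compact_diff: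
  fixes C D :: "'a::real_normed_vector set"
  assumes "weakly_compact C" "weakly_compact D"
  shows "weakly_compact ((\<lambda>z. fst z - snd z) ` (C \<times> D))"
  using assms unfolding weakly_compact_def
  by (intro image_compactin[OF _ continuous_map_weak_topology_diff]) (simp add: compactin_Times)

text \<open>If every point of \<open>W\<close> had a weakly open neighbourhood visited for only
  finitely many indices in \<open>M\<close>, a finite subcover would make \<open>M\<close>
  finite.\<close>

lemma weakly_compact_cluster_point:
  fixes a :: "nat \<Rightarrow> 'a::real_normed_vector"
  assumes W: "weakly_compact W" and a: "\<And>n. a n \<in> W" and inf: "infinite M"
  obtains z where "\<And>(\<phi> :: 'a \<Rightarrow> real) e. bounded_linear \<phi> \<Longrightarrow> 0 < e \<Longrightarrow>
    infinite {n \<in> M. \<bar>\<phi> (a n) - \<phi> z\<bar> < e}"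
proof -
  define \<U> where "\<U> = {V. openin weak_topology V \<and> finite {n \<in> M. a n \<in> V}}"
  have "\<not> W \<subseteq> \<Union>\<U>"
  proof
    assume "W \<subseteq> \<Union>\<U>"
    moreover have "\<forall>V\<in>\<U>. openin weak_topology V" by (simp add: \<U>_def)
    ultimately obtain \<F> where \<F>: "finite \<F>" "\<F> \<subseteq> \<U>" "W \<subseteq> \<Union>\<F>"
      using W unfolding weakly_compact_def compactin_def by metis
    have "M \<subseteq> (\<Union>V\<in>\<F>. {n \<in> M. a n \<in> V})"
      using subsetD[OF \<F>(3) a] by auto
    moreover have "finite (\<Union>V\<in>\<F>. {n \<in> M. a n \<in> V})" using \<F>(1,2) by (auto simp: \<U>_def)
    ultimately show False using inf finite_subset by metis
  qed
  then obtain z where z: "\<And>V. openin weak_topology V \<Longrightarrow> z \<in> V \<Longrightarrow> infinite {n \<in> M. a n \<in> V}"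
    by (auto simp: \<U>_def)
  show ?thesis
  proof (rule that)
    fix \<phi> :: "'a \<Rightarrow> real" and e :: real assume \<phi>: "bounded_linear \<phi>" and e: "0 < e"
    have "infinite {n \<in> M. a n \<in> {x. \<forall>\<psi>\<in>{\<phi>}. \<bar>\<psi> x - \<psi> z\<bar> < e}}"
      by (intro z openin_weak_topology_ball) (use \<phi> e in auto)
    then show "infinite {n \<in> M. \<bar>\<phi> (a n) - \<phi> z\<bar> < e}" by simp
  qed
qed

section \<open>Rational combinations and selection of a weakly null sequence\<close>

text \<open>Coefficient lists form a countable type that does not depend on \<open>a\<close>, so
  they can be enumerated before \<open>a\<close> is constructed; a list \<open>l\<close> involves
  only the first \<open>length l\<close> terms.\<close>

definition rat_combination :: "(nat \<Rightarrow> 'a::real_vector) \<Rightarrow> rat list \<Rightarrow> 'a" where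
  "rat_combination a l = (\<Sum>i<length l. of_rat (l ! i) *\<^sub>R a i)"

lemma rat_combination_cong:
  "(\<And>i. i < length l \<Longrightarrow> a i = b i) \<Longrightarrow> rat_combination a l = rat_combination b l"
  by (simp add: rat_combination_def)

text \<open>Coefficients are indexed by positions, so repeated values of \<open>a\<close> cause no
  trouble; in the induction, shorter sums are padded with zeros.\<close>

lemma span_range_explicit:
  fixes a :: "nat \<Rightarrow> 'a::real_vector"
  assumes "x \<in> span (range a)"
  obtains n c where "x = (\<Sum>i<n. c i *\<^sub>R a i)"
proof -
  have "\<exists>n c. x = (\<Sum>i<n. c i *\<^sub>R a i)"
    using assms
  proof (induction rule: span_induct_alt)
    case base
    show ?case by (rule exI[of _ 0]) simp
  next
    case (step r y x)
    then obtain k n c where y: "y = a k" and x: "x = (\<Sum>i<n. c i *\<^sub>R a i)" by blast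
    define N where "N = max n (Suc k)"
    have "k < N" by (simp add: N_def)
    have "x = (\<Sum>i<N. (if i < n then c i else 0) *\<^sub>R a i)"
      unfolding x by (rule sum.mono_neutral_cong_left) (auto simp: N_def)
    moreover have "r *\<^sub>R y = (\<Sum>i<N. (if i = k then r else 0) *\<^sub>R a i)"
      using \<open>k < N\<close> by (simp add: y if_distrib[of "\<lambda>c. c *\<^sub>R _"] cong: if_cong)
    ultimately have "r *\<^sub>R y + x =
        (\<Sum>i<N. ((if i = k then r else 0) + (if i < n then c i else 0)) *\<^sub>R a i)"
      by (simp add: scaleR_add_left sum.distrib)
    then show ?case by (intro exI)
  qed
  with that show ?thesis by blast
qed

lemma rat_combination_dense:
  fixes a :: "nat \<Rightarrow> 'a::real_normed_vector"
  assumes x: "x \<in> closure (span (range a))" and e: "0 < e"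
  obtains l where "norm (x - rat_combination a l) < e"
proof -
  obtain y where y: "y \<in> span (range a)" "norm (x - y) < e / 2"
    using x e by (metis closure_approachable dist_norm half_gt_zero norm_minus_commute)
  obtain n c where yc: "y = (\<Sum>i<n. c i *\<^sub>R a i)" by (rule span_range_explicit[OF y(1)])
  \<comment> \<open>Half of \<open>e\<close> is spent on the closure. An error
    \<open>\<delta>\<close> in every coefficient costs less than the other half, and the
    \<open>+ 1\<close> keeps the denominator positive.\<close>
  define \<delta> where "\<delta> = e / (2 * ((\<Sum>i<n. norm (a i)) + 1))"
  have S: "0 \<le> (\<Sum>i<n. norm (a i))" by (simp add: sum_nonneg)
  have \<delta>: "0 < \<delta>" using e S by (simp add: \<delta>_def add_nonneg_pos)
  have "\<exists>q. \<bar>c i - of_rat q\<bar> < \<delta>" for i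
  proof -
    obtain q where "c i - \<delta> < of_rat q" "of_rat q < c i"
      using of_rat_dense[of "c i - \<delta>" "c i"] \<delta> by auto
    then show ?thesis by (intro exI[of _ q]) simp
  qed
  then obtain q where q: "\<And>i. \<bar>c i - of_rat (q i)\<bar> < \<delta>" by metis
  have "y - rat_combination a (map q [0..<n]) = (\<Sum>i<n. (c i - of_rat (q i)) *\<^sub>R a i)"
    by (simp add: yc rat_combination_def scaleR_diff_left sum_subtractf)
  also have "norm \<dots> \<le> (\<Sum>i<n. \<delta> * norm (a i))"
    by (rule sum_norm_le) (use q in \<open>auto intro!: mult_right_mono simp: less_imp_le\<close>)
  also have "\<dots> = \<delta> * (\<Sum>i<n. norm (a i))" by (simp add: sum_distrib_left)
  also have "\<dots> < e / 2"
    using e S by (simp add: \<delta>_def field_simps add_nonneg_pos)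
  finally have "norm (x - rat_combination a (map q [0..<n])) < e"
    using y(2) norm_triangle_ineq[of "x - y" "y - rat_combination a (map q [0..<n])"] by simp
  then show ?thesis by (rule that)
qed

text \<open>Whitley's argument: each \<open>a n\<close> is chosen almost in the kernel of functionals norming the
  first few rational combinations of its predecessors. A weak cluster point of \<open>a\<close> lies in the
  closed span of \<open>a\<close>, where these functionals are norming, but is annihilated by all of them.\<close>

lemma weakly_null_sequence_exists:
  fixes A :: "'a::real_normed_vector set"
  assumes W: "weakly_compact W" and AW: "A \<subseteq> W"
    and small: "\<And>(Q :: ('a \<Rightarrow> real) set) e. finite Q \<Longrightarrow> (\<forall>\<phi>\<in>Q. bounded_linear \<phi>) \<Longrightarrow> 0 < e \<Longrightarrow>
      \<exists>x\<in>A. \<forall>\<phi>\<in>Q. \<bar>\<phi> x\<bar> < e"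
  obtains a where "\<And>n::nat. a n \<in> A" "weakly_converges_to a 0"
proof -
  obtain J :: "'a \<Rightarrow> 'a \<Rightarrow> real" where J: "\<And>x. bounded_linear (J x)"
    and J_le: "\<And>x y. \<bar>J x y\<bar> \<le> norm y" and J_norm: "\<And>x. J x x = norm x"
    using exists_norming_functional by metis
  \<comment> \<open>These finite sets increase to all lists. The bound on the length restricts
    combinations at stage \<open>n\<close> to the predecessors of \<open>a n\<close>.\<close>
  define L :: "nat \<Rightarrow> rat list set" where "L n = {l. to_nat l \<le> n \<and> length l \<le> n}" for n
  have L_fin: "finite (L n)" for n
    using finite_vimageI[of "{..n}" "to_nat :: rat list \<Rightarrow> nat"]
    by (rule finite_subset[rotated]) (auto simp: L_def)
  have "\<exists>a. \<forall>n. a n \<in> A \<and> (\<forall>l\<in>L n. \<bar>J (rat_combination a l) (a n)\<bar> < 1 / real (Suc n))"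
  proof (rule dependent_wellorder_choice)
    fix r :: 'a and a b :: "nat \<Rightarrow> 'a" and n
    assume "\<And>i. i < n \<Longrightarrow> a i = b i"
    then have "rat_combination a l = rat_combination b l" if "l \<in> L n" for l
      using that by (intro rat_combination_cong) (auto simp: L_def)
    then show "(r \<in> A \<and> (\<forall>l\<in>L n. \<bar>J (rat_combination a l) r\<bar> < 1 / real (Suc n))) =
      (r \<in> A \<and> (\<forall>l\<in>L n. \<bar>J (rat_combination b l) r\<bar> < 1 / real (Suc n)))" by simp
  next
    fix n and a :: "nat \<Rightarrow> 'a"
    show "\<exists>r. r \<in> A \<and> (\<forall>l\<in>L n. \<bar>J (rat_combination a l) r\<bar> < 1 / real (Suc n))"
      using small[of "(\<lambda>l. J (rat_combination a l)) ` L n" "1 / real (Suc n)"] L_fin J by auto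
  qed
  then obtain a where aA: "\<And>n. a n \<in> A"
    and a: "\<And>n l. l \<in> L n \<Longrightarrow> \<bar>J (rat_combination a l) (a n)\<bar> < 1 / real (Suc n)" by blast
  have J_lim: "(\<lambda>n. J (rat_combination a l) (a n)) \<longlonglongrightarrow> 0" for l
  proof (rule Lim_null_comparison)
    show "\<forall>\<^sub>F n in sequentially. norm (J (rat_combination a l) (a n)) \<le> 1 / real (Suc n)"
      using eventually_ge_at_top[of "max (to_nat l) (length l)"]
      by eventually_elim (use a in \<open>force simp: L_def\<close>)
    show "(\<lambda>n. 1 / real (Suc n)) \<longlonglongrightarrow> 0"
      using LIMSEQ_inverse_real_of_nat by (simp add: inverse_eq_divide)
  qed
  have "(\<lambda>n. \<phi> (a n)) \<longlonglongrightarrow> 0" if \<phi>: "bounded_linear \<phi>" for \<phi> :: "'a \<Rightarrow> real"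
  proof (rule ccontr)
    assume "\<not> (\<lambda>n. \<phi> (a n)) \<longlonglongrightarrow> 0"
    then obtain e where e: "0 < e" and "\<forall>N. \<exists>n\<ge>N. \<not> \<bar>\<phi> (a n)\<bar> < e"
      by (auto simp: lim_sequentially dist_real_def)
    then have inf: "infinite {n. e \<le> \<bar>\<phi> (a n)\<bar>}"
      by (simp add: infinite_nat_iff_unbounded_le not_less)
    \<comment> \<open>The cluster point is taken along indices where \<open>\<phi>\<close> stays at
      least \<open>e\<close> away from 0, so \<open>z = 0\<close> will be contradictory.\<close>
    obtain z where z: "\<And>(\<psi> :: 'a \<Rightarrow> real) d. bounded_linear \<psi> \<Longrightarrow> 0 < d \<Longrightarrow>
        infinite {n \<in> {n. e \<le> \<bar>\<phi> (a n)\<bar>}. \<bar>\<psi> (a n) - \<psi> z\<bar> < d}"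
      by (rule weakly_compact_cluster_point[where a = a, OF W _ inf]) (use aA AW in blast)+
    have zero: "\<psi> z = 0" if \<psi>: "bounded_linear \<psi>" and lim: "(\<lambda>n. \<psi> (a n)) \<longlonglongrightarrow> 0"
      for \<psi> :: "'a \<Rightarrow> real"
    proof (rule ccontr)
      assume "\<psi> z \<noteq> 0"
      then have pos: "0 < \<bar>\<psi> z\<bar> / 2" by simp
      obtain N where N: "\<And>n. N \<le> n \<Longrightarrow> \<bar>\<psi> (a n)\<bar> < \<bar>\<psi> z\<bar> / 2"
        using LIMSEQ_D[OF lim pos] by auto
      obtain n where "N \<le> n" "\<bar>\<psi> (a n) - \<psi> z\<bar> < \<bar>\<psi> z\<bar> / 2"
        using z[OF \<psi> pos] unfolding infinite_nat_iff_unbounded_le mem_Collect_eq by metis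
      with N[of n] show False by linarith
    qed
    \<comment> \<open>A separating functional would vanish on every \<open>a n\<close>, hence at the
      cluster point \<open>z\<close>.\<close>
    have "z \<in> closure (span (range a))"
    proof (rule ccontr)
      assume "z \<notin> closure (span (range a))"
      then obtain \<psi> :: "'a \<Rightarrow> real" where \<psi>: "bounded_linear \<psi>" "\<psi> z \<noteq> 0"
        and "\<And>s. s \<in> span (range a) \<Longrightarrow> \<psi> s = 0"
        using separate_point_from_subspace[OF subspace_span] by metis
      then have "\<psi> (a n) = 0" for n by (simp add: span_base)
      with zero[OF \<psi>(1)] \<psi>(2) show False by simp
    qed
    \<comment> \<open>A combination \<open>?d\<close> within \<open>norm z / 2\<close> of
      \<open>z\<close> has a norming functional that kills \<open>z\<close>, so
      \<open>norm ?d\<close> is at most \<open>norm (z - ?d)\<close>; the triangle inequality then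
      gives \<open>norm z < norm z\<close>.\<close>
    have "z = 0"
    proof (rule ccontr)
      assume "z \<noteq> 0"
      then obtain l where l: "norm (z - rat_combination a l) < norm z / 2"
        using rat_combination_dense[OF \<open>z \<in> _\<close>, of "norm z / 2"] by auto
      let ?d = "rat_combination a l"
      have "J ?d z = 0" by (rule zero[OF J J_lim])
      then have "J ?d (z - ?d) = - norm ?d"
        by (simp add: linear_diff[OF bounded_linear.linear[OF J]] J_norm)
      then have "norm ?d \<le> norm (z - ?d)" using J_le[of ?d "z - ?d"] by simp
      with l norm_triangle_ineq[of "z - ?d" ?d] show False by simp
    qed
    then have "\<phi> z = 0" using linear_0[OF bounded_linear.linear[OF \<phi>]] by simp
    moreover have "infinite {n \<in> {n. e \<le> \<bar>\<phi> (a n)\<bar>}. \<bar>\<phi> (a n) - \<phi> z\<bar> < e}"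
      by (rule z[OF \<phi> e])
    moreover have "{n. e \<le> \<bar>\<phi> (a n)\<bar> \<and> \<bar>\<phi> (a n)\<bar> < e} = {}" by auto
    ultimately show False by simp
  qed
  then have "weakly_converges_to a 0"
    unfolding weakly_converges_to_iff
    by (metis bounded_linear.linear linear_0)
  with aA show ?thesis by (rule that)
qed

theorem theorem3p3:
  fixes C :: "'a::banach set" and f :: "'a \<Rightarrow> 'a"
  assumes "C \<noteq> {}" and "weakly_compact C" and "convex C"
    and "f \<in> C \<rightarrow> C" and "demicontinuous_on C f"
  shows "\<exists>x :: nat \<Rightarrow> 'a. (\<forall>n. x n \<in> C) \<and> weakly_converges_to (\<lambda>n. x n - f (x n)) 0"
proof -
  \<comment> \<open>The displacements are placed in \<open>C - C\<close>, a weakly compact set as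
    the continuous image of \<open>C \<times> C\<close>.\<close>
  have sub: "(\<lambda>x. x - f x) ` C \<subseteq> (\<lambda>z. fst z - snd z) ` (C \<times> C)"
  proof (rule image_subsetI)
    fix x assume "x \<in> C"
    with funcset_mem[OF assms(4)] have "(x, f x) \<in> C \<times> C" by simp
    then show "x - f x \<in> (\<lambda>z. fst z - snd z) ` (C \<times> C)" by (rule image_eqI[rotated]) simp
  qed
  have small: "\<exists>y\<in>(\<lambda>x. x - f x) ` C. \<forall>\<phi>\<in>Q. \<bar>\<phi> y\<bar> < e"
    if Q: "finite Q" "\<forall>\<phi>\<in>Q. bounded_linear \<phi>" and e: "0 < e" for Q :: "('a \<Rightarrow> real) set" and e
  proof -
    obtain x where "x \<in> C" "\<And>\<phi>. \<phi> \<in> Q \<Longrightarrow> \<bar>\<phi> (x - f x)\<bar> < e"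
      by (rule finite_functionals_approximate_fixed_point[OF assms Q(1) _ e]) (use Q(2) in auto)
    then show ?thesis by auto
  qed
  obtain a where a: "\<And>n::nat. a n \<in> (\<lambda>x. x - f x) ` C" "weakly_converges_to a 0"
    using weakly_null_sequence_exists[OF weakly_compact_diff[OF assms(2,2)] sub small] by metis
  have "\<forall>n. \<exists>x\<in>C. a n = x - f x" using a(1) by (simp add: image_iff)
  then obtain x where x: "\<And>n. x n \<in> C" "\<And>n. a n = x n - f (x n)" by metis
  have "a = (\<lambda>n. x n - f (x n))" by (rule ext) (rule x(2))
  with x(1) a(2) show ?thesis by auto
qed

end
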